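(* There exist irrational real numbers $\beta>0$ such that $$\lambda(\mathcal{A}(\bm{a}(\beta)))=\lambda(\mathcal{A}(\bm{b}(\beta)))=0.$$
   Context: The index $p$ runs over primes; $n_p\geq1$ is the integer such that $p$ is the $n_p$-th prime in increasing order. For an integer $n$ and a prime $p$, $n\pmod p$ denotes the unique integer in $\{0,\ldots,p-1\}$ congruent to $n$ modulo $p$. For a real number $\beta>0$, $\bm{a}(\beta)=(a_p)_p$ and $\bm{b}(\beta)=(b_p)_p$ are given by $a_p=\lfloor\beta pn_p\rfloor\pmod p$ and $b_p=\lfloor\beta p^2\rfloor\pmod p$. For a sequence $\bm{a}=(a_p)_p$ of integers with $0\leq a_p<p$, $\mathcal{A}(\bm{a})=\{x\in[0,1] : \liminf_{p\to\infty}p|x-a_p/p|=0\}$. $\lambda$ is Lebesgue measure on $[0,1]$. *)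

theory Defs
  imports "HOL-Analysis.Analysis" "HOL-Computational_Algebra.Primes"
begin

text \<open>
  Sequences indexed by primes are functions on \<^typ>\<open>nat\<close>; their values at non-primes are never used,
  since limits are taken along the following filter (\<open>p\<close> tends to infinity through the primes).
\<close>

definition primes_at_top :: "nat filter" where
  "primes_at_top = inf sequentially (principal {p. prime p})"

text \<open>For prime \<open>p\<close>, this is the \<open>n\<close> such that \<open>p\<close> is the \<open>n\<close>-th prime, counting from 1.\<close>

definition prime_index :: "nat \<Rightarrow> nat" where
  "prime_index p = card {q. prime q \<and> q \<le> p}"

definition a_seq :: "real \<Rightarrow> nat \<Rightarrow> int" where
  "a_seq \<beta> p = \<lfloor>\<beta> * real p * real (prime_index p)\<rfloor> mod int p"

definition b_seq :: "real \<Rightarrow> nat \<Rightarrow> int" where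
  "b_seq \<beta> p = \<lfloor>\<beta> * (real p)\<^sup>2\<rfloor> mod int p"

text \<open>The lower limit is taken in the extended reals, as it may be infinite.\<close>

definition prime_approx_set :: "(nat \<Rightarrow> int) \<Rightarrow> real set" where
  "prime_approx_set a = {x \<in> {0..1}.
     Liminf primes_at_top (\<lambda>p. ereal (real p * \<bar>x - real_of_int (a p) / real p\<bar>)) = 0}"

end

theory Submission
  imports Defs
begin

text \<open>
  Take \<open>\<beta> = (\<Sum>j. 1 / q\<^sub>j)\<close> with \<open>q\<^sub>j = 2 ^ e\<^sub>j\<close> and \<open>e\<^sub>j = 2 ^ (j + 1)\<^sup>2\<close>. Both sequences have the form
  \<open>c p = \<lfloor>\<beta> p m\<rfloor> mod p\<close> with an integer multiplier \<open>0 \<le> m \<le> p\<close>. A point of the set lies in infinitely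
  many of the intervals of radius \<open>1 / p\<close> about \<open>c p / p\<close>. As long as \<open>2 ^ j q\<^sub>j < p \<le> 2 ^ -j q\<^sub>j\<^sub>+\<^sub>1 / q\<^sub>j\<close>,
  the number \<open>\<beta>\<close> is so close to a fraction with denominator \<open>q\<^sub>j\<close> that all these intervals cluster near
  the fractions \<open>l / q\<^sub>j\<close>, and their union has measure \<open>O(2 ^ -j)\<close>. The remaining primes up to
  \<open>2 ^ (j + 1) q\<^sub>j\<^sub>+\<^sub>1\<close> fill only about \<open>e\<^sub>j\<close> dyadic blocks near \<open>2 ^ e\<^sub>j\<^sub>+\<^sub>1\<close>, each of which contributes
  \<open>O(1 / e\<^sub>j\<^sub>+\<^sub>1)\<close> by Chebyshev's bound. Since \<open>e\<^sub>j / e\<^sub>j\<^sub>+\<^sub>1\<close> is summable, Borel--Cantelli applies.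
\<close>

subsection \<open>Primes in dyadic blocks\<close>

text \<open>Chebyshev's argument: each prime in \<open>(n, 2 * n]\<close> divides
  \<open>2 * n choose n\<close>, hence so does their product, whose factors all exceed
  \<open>n\<close>; the binomial coefficient is at most \<open>4 ^ n\<close>.\<close>

lemma power_card_primes_le_four_power:
  "n ^ card {p. prime p \<and> n < p \<and> p \<le> 2 * n} \<le> (4::nat) ^ n"
proof -
  let ?P = "{p. prime p \<and> n < p \<and> p \<le> 2 * n}"
  have fin: "finite ?P"
    by (rule finite_subset[of _ "{..2 * n}"]) auto
  have dvd: "p dvd (2 * n choose n)" if "p \<in> ?P" for p
  proof -
    have "fact n * fact n * (2 * n choose n) = (fact (2 * n) :: nat)"
      using binomial_fact_lemma[of n "2 * n"] by simp
    moreover have "p dvd fact (2 * n)" "\<not> p dvd fact n"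
      using that by (auto simp: prime_dvd_fact_iff)
    ultimately show ?thesis
      using that by (metis (no_types, lifting) mem_Collect_eq prime_dvd_mult_iff)
  qed
  have prod_dvd: "\<Prod>A dvd (2 * n choose n)" if "A \<subseteq> ?P" for A
    using finite_subset[OF that fin] that
  proof (induction A)
    case (insert p A)
    have "coprime p (\<Prod>A)"
      using insert by (intro prod_coprime_right) (auto intro!: primes_coprime)
    then show ?case
      using insert dvd by (simp add: divides_mult)
  qed simp
  have "n ^ card ?P \<le> \<Prod>?P"
    using prod_mono[of ?P "\<lambda>_. n" "\<lambda>p. p"] by auto
  also have "\<dots> \<le> (2 * n choose n)"
    by (intro dvd_imp_le prod_dvd) auto
  also have "\<dots> \<le> 4 ^ n"
    using binomial_le_pow2[of "2 * n" n] by (simp add: power_mult)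
  finally show ?thesis .
qed

lemma card_primes_dyadic_le:
  "i * card {p::nat. prime p \<and> 2 ^ i < p \<and> p \<le> 2 ^ Suc i} \<le> (2::nat) * 2 ^ i"
proof -
  let ?c = "card {p::nat. prime p \<and> 2 ^ i < p \<and> p \<le> 2 ^ Suc i}"
  have "(2::nat) ^ (i * ?c) \<le> 2 ^ (2 * 2 ^ i)"
    using power_card_primes_le_four_power[of "2 ^ i"] by (simp add: power_mult)
  then show ?thesis
    by (simp add: power_le_imp_le_exp)
qed

subsection \<open>Unions of approximation intervals\<close>

text \<open>Radius \<open>1 / p\<close> is small enough: a point outside all but finitely many of
  these intervals has lower limit at least 1, hence not 0.\<close>

definition approx_interval :: "(nat \<Rightarrow> int) \<Rightarrow> nat \<Rightarrow> real set" where
  "approx_interval c p = {(real_of_int (c p) - 1) / real p .. (real_of_int (c p) + 1) / real p}"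

lemma measure_approx_interval: "measure lborel (approx_interval c p) = 2 / real p"
proof -
  have "(real_of_int (c p) - 1) / real p \<le> (real_of_int (c p) + 1) / real p"
    by (intro divide_right_mono) auto
  then show ?thesis
    unfolding approx_interval_def by (simp add: diff_divide_distrib add_divide_distrib)
qed

lemma fmeasurable_UN_approx_interval:
  "finite P \<Longrightarrow> (\<Union>p\<in>P. approx_interval c p) \<in> fmeasurable lborel"
  by (intro fmeasurable_compact compact_UN) (auto simp: approx_interval_def)

lemma measure_UN_dyadic_le:
  assumes "i > 0"
  shows "measure lborel (\<Union>p\<in>{p. prime p \<and> 2 ^ i < p \<and> p \<le> 2 ^ Suc i}. approx_interval c p)
    \<le> 4 / real i"
proof -
  let ?P = "{p::nat. prime p \<and> 2 ^ i < p \<and> p \<le> 2 ^ Suc i}"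
  have fin: "finite ?P"
    by (rule finite_subset[of _ "{..2 ^ Suc i}"]) auto
  have "measure lborel (\<Union>p\<in>?P. approx_interval c p) \<le> (\<Sum>p\<in>?P. 2 / real p)"
    using measure_UNION_le[OF fin, of "approx_interval c" lborel]
    by (simp add: measure_approx_interval) (simp add: approx_interval_def)
  also have "\<dots> \<le> (\<Sum>p\<in>?P. 2 / 2 ^ i)"
  proof (rule sum_mono)
    fix p assume "p \<in> ?P"
    then have "real (2 ^ i) \<le> real p"
      by (simp only: of_nat_le_iff) auto
    then show "2 / real p \<le> 2 / 2 ^ i"
      by (intro frac_le) auto
  qed
  also have "\<dots> = real (card ?P) * 2 / 2 ^ i"
    by simp
  also have "\<dots> \<le> 4 / real i"
  proof -
    have "real (i * card ?P) \<le> real (2 * 2 ^ i)"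
      using card_primes_dyadic_le[of i] by (simp only: of_nat_le_iff)
    then show ?thesis
      using assms by (simp add: field_simps)
  qed
  finally show ?thesis .
qed

text \<open>Adds up the dyadic bounds \<open>4 / i\<close> for \<open>i\<close> from
  \<open>t\<close> to \<open>s - 1\<close>, each replaced by \<open>4 / t\<close>. This is strong
  when \<open>s - t\<close> is small compared with \<open>t\<close>.\<close>

lemma measure_UN_primes_le:
  assumes "t > 0" "t \<le> s"
  shows "measure lborel (\<Union>p\<in>{p. prime p \<and> 2 ^ t < p \<and> p \<le> 2 ^ s}. approx_interval c p)
    \<le> 4 * (real s - real t) / real t"
  using assms(2)
proof (induction s rule: dec_induct)
  case base
  have "{p::nat. prime p \<and> 2 ^ t < p \<and> p \<le> 2 ^ t} = {}"
    by auto
  then show ?case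
    by (simp only: UN_empty) simp
next
  case (step s)
  let ?A = "\<Union>p\<in>{p. prime p \<and> 2 ^ t < p \<and> p \<le> 2 ^ s}. approx_interval c p"
  let ?B = "\<Union>p\<in>{p. prime p \<and> 2 ^ s < p \<and> p \<le> 2 ^ Suc s}. approx_interval c p"
  have fin: "finite {p::nat. prime p \<and> a < p \<and> p \<le> b}" for a b
    by (rule finite_subset[of _ "{..b}"]) auto
  have "(2::nat) ^ t \<le> 2 ^ s"
    using step by (intro power_increasing) auto
  then have "{p::nat. prime p \<and> 2 ^ t < p \<and> p \<le> 2 ^ Suc s} =
      {p. prime p \<and> 2 ^ t < p \<and> p \<le> 2 ^ s} \<union> {p. prime p \<and> 2 ^ s < p \<and> p \<le> 2 ^ Suc s}"
    using power_increasing[of s "Suc s" "2::nat"] unfolding set_eq_iff Un_iff mem_Collect_eq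
    by (meson le_less_trans lessI less_imp_le not_le order_trans one_le_numeral)
  then have "measure lborel (\<Union>p\<in>{p. prime p \<and> 2 ^ t < p \<and> p \<le> 2 ^ Suc s}. approx_interval c p)
      = measure lborel (?A \<union> ?B)"
    by (simp only: UN_Un)
  also have "\<dots> \<le> measure lborel ?A + measure lborel ?B"
    by (intro measure_Un_le fmeasurableD fmeasurable_UN_approx_interval fin)
  also have "measure lborel ?B \<le> 4 / real s"
    using assms step by (intro measure_UN_dyadic_le) auto
  also have "4 / real s \<le> 4 / real t"
    using assms step by (intro divide_left_mono) auto
  also note step.IH
  finally show ?case
    by (simp add: add_divide_distrib diff_divide_distrib algebra_simps)
qed

text \<open>Modulo 1, \<open>c p / p\<close> is close to \<open>m p * \<beta>\<close>, which is
  close to \<open>m p * r / q\<close>; the quotient \<open>d\<close> of the reduction mod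
  \<open>p\<close> turns this into an actual fraction \<open>l / q\<close>.\<close>

lemma approx_interval_near_rational:
  fixes \<beta> \<eta> :: real and r :: int and q :: nat and m :: "nat \<Rightarrow> nat"
  assumes c: "c = (\<lambda>p. \<lfloor>\<beta> * real p * real (m p)\<rfloor> mod int p)"
    and q: "q > 0" and q\<eta>: "real q * \<eta> \<le> 2" and r: "real_of_int r / real q \<le> \<beta>"
    and p: "p > 0" "1 / real p \<le> \<eta>" "real (m p) * (\<beta> - real_of_int r / real q) \<le> \<eta>"
    and x: "x \<in> approx_interval c p"
  shows "\<exists>l\<in>{-2..int q + 2}. x \<in> {real_of_int l / real q - 2 * \<eta> .. real_of_int l / real q + 2 * \<eta>}"
proof -
  define z where "z = \<lfloor>\<beta> * real p * real (m p)\<rfloor>"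
  define d where "d = z div int p"
  define l where "l = int (m p) * r - d * int q"
  define y where "y = real_of_int (c p) / real p"
  have cp: "c p = z - int p * d" "0 \<le> c p" "c p < int p"
    using p(1) unfolding c z_def d_def by (auto simp: minus_mult_div_eq_mod)
  have y_eq: "y = real_of_int z / real p - real_of_int d"
    unfolding y_def cp(1) using p(1) by (simp add: field_simps)
  have l_eq: "real_of_int l / real q = real (m p) * (real_of_int r / real q) - real_of_int d"
    unfolding l_def using q by (simp add: field_simps)
  have "real_of_int z \<le> \<beta> * real p * real (m p)" "\<beta> * real p * real (m p) \<le> real_of_int z + 1"
    unfolding z_def by linarith+
  then have z: "real_of_int z / real p \<le> \<beta> * real (m p)"
      "\<beta> * real (m p) \<le> real_of_int z / real p + 1 / real p"
    using p(1) by (simp_all add: field_simps)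
  have "0 \<le> real (m p) * (\<beta> - real_of_int r / real q)"
    using r by simp
  \<comment> \<open>The floor lowers \<open>y\<close>, while \<open>r / q\<close> lies below
    \<open>\<beta>\<close>: the two errors have opposite signs, so \<open>\<eta>\<close> suffices
    instead of \<open>2 * \<eta>\<close>.\<close>
  then have yl: "\<bar>y - real_of_int l / real q\<bar> \<le> \<eta>"
    unfolding y_eq l_eq abs_le_iff using z p by (simp only: right_diff_distrib mult.commute) linarith
  have y01: "0 \<le> y" "y \<le> 1"
    unfolding y_def using cp p(1) by (auto simp: field_simps)
  have "real_of_int l / real q * real q \<le> (1 + \<eta>) * real q"
    using yl y01 by (intro mult_right_mono) auto
  moreover have "(- \<eta>) * real q \<le> real_of_int l / real q * real q"
    using yl y01 by (intro mult_right_mono) auto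
  ultimately have "-2 \<le> real_of_int l" "real_of_int l \<le> real q + 2"
    using q q\<eta> by (auto simp: algebra_simps)
  then have "l \<in> {-2..int q + 2}"
    by auto
  moreover have "\<bar>x - y\<bar> \<le> \<eta>"
    using x p unfolding approx_interval_def y_def abs_le_iff
    by (simp add: diff_divide_distrib add_divide_distrib)
  ultimately show ?thesis
    using yl unfolding atLeastAtMost_iff[of x] by (intro bexI[of _ l]) linarith+
qed

text \<open>The union is covered by \<open>q + 5\<close> intervals of length
  \<open>4 * \<eta>\<close>, however many primes \<open>P\<close> contains, and \<open>q + 5\<close>
  is at most \<open>6 * q\<close>.\<close>

lemma measure_UN_near_rational_le:
  fixes \<beta> \<eta> :: real and r :: int and q :: nat and m :: "nat \<Rightarrow> nat"
  assumes c: "c = (\<lambda>p. \<lfloor>\<beta> * real p * real (m p)\<rfloor> mod int p)"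
    and q: "q > 0" and \<eta>: "\<eta> > 0" and q\<eta>: "real q * \<eta> \<le> 2" and r: "real_of_int r / real q \<le> \<beta>"
    and P: "\<And>p. p \<in> P \<Longrightarrow> p > 0 \<and> 1 / real p \<le> \<eta> \<and> real (m p) * (\<beta> - real_of_int r / real q) \<le> \<eta>"
    and fin: "finite P"
  shows "measure lborel (\<Union>p\<in>P. approx_interval c p) \<le> 24 * real q * \<eta>"
proof -
  let ?J = "\<lambda>l::int. {real_of_int l / real q - 2 * \<eta> .. real_of_int l / real q + 2 * \<eta>}"
  have "measure lborel (\<Union>p\<in>P. approx_interval c p) \<le> measure lborel (\<Union>l\<in>{-2..int q + 2}. ?J l)"
  proof (rule measure_mono_fmeasurable)
    show "(\<Union>p\<in>P. approx_interval c p) \<subseteq> (\<Union>l\<in>{-2..int q + 2}. ?J l)"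
    proof
      fix x assume "x \<in> (\<Union>p\<in>P. approx_interval c p)"
      then obtain p where "p \<in> P" "x \<in> approx_interval c p"
        by blast
      then show "x \<in> (\<Union>l\<in>{-2..int q + 2}. ?J l)"
        unfolding UN_iff using P[of p] by (intro approx_interval_near_rational[OF c q q\<eta> r]) auto
    qed
    show "(\<Union>p\<in>P. approx_interval c p) \<in> sets lborel"
      using fmeasurable_UN_approx_interval[OF fin] by blast
    show "(\<Union>l\<in>{-2..int q + 2}. ?J l) \<in> fmeasurable lborel"
      by (intro fmeasurable_compact compact_UN) auto
  qed
  also have "\<dots> \<le> (\<Sum>l\<in>{-2..int q + 2}. measure lborel (?J l))"
    by (rule measure_UNION_le) auto
  also have "\<dots> = (\<Sum>l\<in>{-2..int q + 2}. 4 * \<eta>)"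
    using \<eta> by (intro sum.cong refl) simp
  also have "\<dots> = (real q + 5) * (4 * \<eta>)"
    by simp
  also have "\<dots> \<le> (6 * real q) * (4 * \<eta>)"
    using \<eta> q by (intro mult_right_mono) auto
  finally show ?thesis
    by simp
qed

subsection \<open>A Liouville number\<close>

text \<open>The square makes successive ratios grow like \<open>4 ^ j\<close>, so that their
  reciprocals are summable; exponents \<open>2 ^ j\<close> would give a constant ratio.\<close>

definition gap_exp :: "nat \<Rightarrow> nat" where
  "gap_exp j = 2 ^ (Suc j)\<^sup>2"

lemma gap_exp_Suc: "gap_exp (Suc j) = 8 * 4 ^ j * gap_exp j"
proof -
  have "(Suc (Suc j))\<^sup>2 = 3 + 2 * j + (Suc j)\<^sup>2"
    by (simp add: power2_eq_square algebra_simps)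
  then show ?thesis
    unfolding gap_exp_def by (simp add: power_add power_mult)
qed

lemma Suc_le_gap_exp: "Suc j \<le> gap_exp j"
proof -
  have "Suc j \<le> (Suc j)\<^sup>2"
    by (simp add: power2_eq_square)
  also have "\<dots> \<le> 2 ^ (Suc j)\<^sup>2"
    by (rule less_imp_le[OF less_exp])
  finally show ?thesis
    by (simp add: gap_exp_def)
qed

lemma strict_mono_gap_exp: "strict_mono gap_exp"
proof (rule strict_monoI_Suc)
  fix j
  have "gap_exp j < 8 * gap_exp j"
    using Suc_le_gap_exp[of j] by simp
  also have "\<dots> \<le> 8 * 4 ^ j * gap_exp j"
    by simp
  finally show "gap_exp j < gap_exp (Suc j)"
    by (simp only: gap_exp_Suc)
qed

definition liouville :: real where
  "liouville = (\<Sum>j. (1 / 2) ^ gap_exp j)"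

lemma liouville_tail_le:
  "summable (\<lambda>k. (1 / 2 :: real) ^ gap_exp (k + j))"
  "(\<Sum>k. (1 / 2 :: real) ^ gap_exp (k + j)) \<le> 2 * (1 / 2) ^ gap_exp j"
proof -
  have le: "(1 / 2 :: real) ^ gap_exp (k + j) \<le> (1 / 2) ^ gap_exp j * (1 / 2) ^ k" for k
  proof -
    have "k + gap_exp j \<le> gap_exp (k + j)"
    proof (induction k)
      case (Suc k)
      then show ?case
        using strict_monoD[OF strict_mono_gap_exp, of "k + j" "Suc k + j"] by simp
    qed simp
    then have "(1 / 2 :: real) ^ gap_exp (k + j) \<le> (1 / 2) ^ (k + gap_exp j)"
      by (intro power_decreasing) auto
    then show ?thesis
      by (simp add: power_add mult.commute)
  qed
  have geo: "summable (\<lambda>k. (1 / 2 :: real) ^ gap_exp j * (1 / 2) ^ k)"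
    by (intro summable_mult summable_geometric) simp
  show "summable (\<lambda>k. (1 / 2 :: real) ^ gap_exp (k + j))"
    by (rule summable_comparison_test'[OF geo, of 0]) (use le in auto)
  then have "(\<Sum>k. (1 / 2 :: real) ^ gap_exp (k + j)) \<le> (\<Sum>k. (1 / 2) ^ gap_exp j * (1 / 2) ^ k)"
    by (intro suminf_le geo le)
  also have "\<dots> = 2 * (1 / 2) ^ gap_exp j"
    using suminf_geometric[of "1 / 2 :: real"]
    by (subst suminf_mult) (auto intro: summable_geometric)
  finally show "(\<Sum>k. (1 / 2 :: real) ^ gap_exp (k + j)) \<le> 2 * (1 / 2) ^ gap_exp j" .
qed

text \<open>The fraction is the partial sum up to index \<open>j\<close>; the error is the remaining
  tail, which is positive and dominated by a geometric series with ratio 1/2.\<close>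

lemma liouville_approx:
  "\<exists>r::int. real_of_int r / 2 ^ gap_exp j < liouville \<and>
     liouville - real_of_int r / 2 ^ gap_exp j \<le> 2 / 2 ^ gap_exp (Suc j)"
proof -
  define r :: int where "r = (\<Sum>i<Suc j. 2 ^ (gap_exp j - gap_exp i))"
  have "real_of_int r / 2 ^ gap_exp j = (\<Sum>i<Suc j. (1 / 2) ^ gap_exp i)"
    unfolding r_def of_int_sum sum_divide_distrib
  proof (rule sum.cong)
    fix i assume "i \<in> {..<Suc j}"
    then have "gap_exp i \<le> gap_exp j"
      using strict_mono_gap_exp by (simp add: strict_mono_less_eq)
    then show "real_of_int (2 ^ (gap_exp j - gap_exp i)) / 2 ^ gap_exp j = (1 / 2) ^ gap_exp i"
      unfolding of_int_power of_int_numeral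
      by (subst power_diff) (simp_all add: power_one_over)
  qed simp
  moreover have "liouville = (\<Sum>k. (1 / 2) ^ gap_exp (k + Suc j)) + (\<Sum>i<Suc j. (1 / 2) ^ gap_exp i)"
    unfolding liouville_def using liouville_tail_le(1)[of 0]
    by (intro suminf_split_initial_segment) simp
  moreover have "(\<Sum>k. (1 / 2 :: real) ^ gap_exp (k + Suc j)) > 0"
    by (intro suminf_pos liouville_tail_le) auto
  ultimately show ?thesis
    using liouville_tail_le(2)[of "Suc j"] by (intro exI[of _ r]) (simp add: power_one_over)
qed

lemma liouville_pos: "liouville > 0"
  unfolding liouville_def using liouville_tail_le(1)[of 0] by (intro suminf_pos) auto

text \<open>A fraction \<open>a / b\<close> different from \<open>r / 2 ^ gap_exp j\<close> is at
  least \<open>1 / (b * 2 ^ gap_exp j)\<close> away from it, contradicting the tail bound.\<close>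

lemma liouville_irrational: "liouville \<notin> \<rat>"
proof
  assume "liouville \<in> \<rat>"
  then obtain a b :: int where b: "b > 0" and ab: "liouville = real_of_int a / real_of_int b"
    by (auto elim: Rats_cases')
  \<comment> \<open>This choice gives \<open>b < 2 ^ j\<close>, which absorbs the
    denominator.\<close>
  define j where "j = nat b"
  obtain r :: int where r: "real_of_int r / 2 ^ gap_exp j < liouville"
      "liouville - real_of_int r / 2 ^ gap_exp j \<le> 2 / 2 ^ gap_exp (Suc j)"
    using liouville_approx by blast
  define X where "X = a * 2 ^ gap_exp j - r * b"
  have eq: "liouville - real_of_int r / 2 ^ gap_exp j = real_of_int X / (real_of_int b * 2 ^ gap_exp j)"
    unfolding ab X_def using b by (simp add: field_simps)
  have "0 < real_of_int X / (real_of_int b * 2 ^ gap_exp j)"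
    using r(1) eq by linarith
  then have "X > 0"
    using b by (auto simp: zero_less_divide_iff mult_less_0_iff)
  then have "real_of_int X \<ge> 1"
    by linarith
  then have "1 / (real_of_int b * 2 ^ gap_exp j) \<le> 2 / 2 ^ gap_exp (Suc j)"
    using b r(2) unfolding eq by (smt (verit) divide_right_mono mult_pos_pos of_int_0_less_iff zero_less_power)
  then have "2 ^ gap_exp (Suc j) \<le> 2 * real_of_int b * 2 ^ gap_exp j"
    using b by (simp add: field_simps)
  also have "\<dots> < 2 * 2 ^ j * 2 ^ gap_exp j"
    using b of_nat_less_two_power[of j, where 'a = real] by (simp add: j_def)
  also have "\<dots> = 2 ^ (Suc j + gap_exp j)"
    by (simp add: power_add)
  also have "\<dots> \<le> 2 ^ gap_exp (Suc j)"
  proof (rule power_increasing)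
    have "2 * gap_exp j \<le> gap_exp (Suc j)"
      unfolding gap_exp_Suc by (intro mult_right_mono) (auto intro: order_trans[of _ "8 * 1"])
    then show "Suc j + gap_exp j \<le> gap_exp (Suc j)"
      using Suc_le_gap_exp[of j] by simp
  qed simp
  finally show False
    by simp
qed

subsection \<open>The Borel--Cantelli argument\<close>

text \<open>Consecutive blocks abut. Starting a factor \<open>2 ^ j\<close> above
  \<open>2 ^ gap_exp j\<close> makes \<open>1 / p\<close> small against the spacing of fractions
  with that denominator.\<close>

definition prime_block :: "nat \<Rightarrow> nat set" where
  "prime_block j = {p. prime p \<and> 2 ^ (gap_exp j + j) < p \<and> p \<le> 2 ^ (gap_exp (Suc j) + Suc j)}"

lemma finite_prime_block: "finite (prime_block j)"
  by (rule finite_subset[of _ "{..2 ^ (gap_exp (Suc j) + Suc j)}"]) (auto simp: prime_block_def)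

lemma ex_prime_block:
  assumes "prime p" "p > 2 ^ gap_exp 0"
  shows "\<exists>j. p \<in> prime_block j"
proof -
  let ?s = "\<lambda>j. (2::nat) ^ (gap_exp j + j)"
  have "p < ?s p"
    using less_exp[of "gap_exp p + p"] by linarith
  then have ex: "\<exists>j. p \<le> ?s j"
    using less_imp_le by blast
  define k where "k = (LEAST j. p \<le> ?s j)"
  have k: "p \<le> ?s k"
    unfolding k_def using ex by (rule LeastI_ex)
  \<comment> \<open>The index 0 is excluded because \<open>p > 2 ^ gap_exp 0\<close>.\<close>
  then obtain j where j: "k = Suc j"
    using assms by (cases k) auto
  have "\<not> p \<le> ?s j"
    using not_less_Least[of j "\<lambda>j. p \<le> ?s j"] j k_def by simp
  then show ?thesis
    using assms k j by (auto simp: prime_block_def not_le)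
qed

lemma measure_prime_block_le:
  fixes m :: "nat \<Rightarrow> nat"
  assumes c: "c = (\<lambda>p. \<lfloor>liouville * real p * real (m p)\<rfloor> mod int p)"
    and m: "\<And>p. m p \<le> p"
  shows "measure lborel (\<Union>p\<in>prime_block j. approx_interval c p) \<le> 64 * (1 / 2) ^ j"
proof -
  define e where "e = gap_exp j"
  define E where "E = gap_exp (Suc j)"
  \<comment> \<open>The largest exponent for which the approximation error \<open>2 / 2 ^ E\<close>,
    multiplied by \<open>2 ^ t\<close>, is still at most \<open>2 / 2 ^ (e + j)\<close>. The
    subtraction does not truncate, since \<open>j < e\<close> and
    \<open>8 * e \<le> E\<close>.\<close>
  define t where "t = E - e - j"
  have e: "Suc j \<le> e" and E: "E = 8 * 4 ^ j * e"
    unfolding e_def E_def by (rule Suc_le_gap_exp, rule gap_exp_Suc)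
  have "8 * e \<le> E"
    unfolding E by simp
  then have t: "t + e + j = E" "e + j \<le> t"
    using e unfolding t_def by auto
  let ?U = "\<lambda>P. \<Union>p\<in>P. approx_interval c p"
  let ?A = "{p::nat. prime p \<and> 2 ^ (e + j) < p \<and> p \<le> 2 ^ t}"
  let ?B = "{p::nat. prime p \<and> 2 ^ t < p \<and> p \<le> 2 ^ (E + Suc j)}"
  have fin: "finite {p::nat. prime p \<and> a < p \<and> p \<le> b}" for a b
    by (rule finite_subset[of _ "{..b}"]) auto
  have "(2::nat) ^ (e + j) \<le> 2 ^ t" "(2::nat) ^ t \<le> 2 ^ (E + Suc j)"
    using t by (auto intro!: power_increasing simp del: power_Suc)
  then have "prime_block j = ?A \<union> ?B"
    unfolding prime_block_def e_def[symmetric] E_def[symmetric] set_eq_iff Un_iff mem_Collect_eq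
    by (meson le_less_trans not_le order_trans)
  then have "measure lborel (?U (prime_block j)) = measure lborel (?U ?A \<union> ?U ?B)"
    by (simp only: UN_Un)
  also have "\<dots> \<le> measure lborel (?U ?A) + measure lborel (?U ?B)"
    by (intro measure_Un_le fmeasurableD fmeasurable_UN_approx_interval fin)
  also have "measure lborel (?U ?A) \<le> 24 * real (2 ^ e) * (2 / 2 ^ (e + j))"
  proof -
    obtain r :: int where r: "real_of_int r / 2 ^ e < liouville"
        "liouville - real_of_int r / 2 ^ e \<le> 2 / 2 ^ E"
      using liouville_approx[of j] unfolding e_def E_def by blast
    show ?thesis
    proof (rule measure_UN_near_rational_le[OF c _ _ _ _ _ fin, where r = r])
      fix p assume p: "p \<in> ?A"
      then have "real (2 ^ (e + j)) \<le> real p" "real p \<le> real (2 ^ t)"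
        by (simp_all only: of_nat_le_iff) auto
      then have p': "2 ^ (e + j) \<le> real p" "real p \<le> 2 ^ t"
        by simp_all
      have "1 / real p \<le> 2 / 2 ^ (e + j)"
        using p' by (intro frac_le) auto
      moreover have "real (m p) * (liouville - real_of_int r / real (2 ^ e)) \<le> 2 / 2 ^ (e + j)"
      proof -
        have "real (m p) * (liouville - real_of_int r / 2 ^ e) \<le> 2 ^ t * (2 / 2 ^ E)"
          using r p' m[of p] by (intro mult_mono) auto
        also have "\<dots> = 2 / 2 ^ (e + j)"
          unfolding t(1)[symmetric] by (simp add: power_add)
        finally show ?thesis
          by simp
      qed
      ultimately show "0 < p \<and> 1 / real p \<le> 2 / 2 ^ (e + j) \<and>
          real (m p) * (liouville - real_of_int r / real (2 ^ e)) \<le> 2 / 2 ^ (e + j)"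
        using p by (auto intro: prime_gt_0_nat)
    qed (use r in \<open>auto simp: power_add field_simps\<close>)
  qed
  also have "\<dots> = 48 * (1 / 2) ^ j"
    by (simp add: power_add power_one_over)
  \<comment> \<open>Here \<open>?B\<close> spans \<open>e + 2 * j + 1 \<le> 4 * e\<close> dyadic
    blocks, while \<open>t\<close> is at least \<open>2 ^ j * e\<close>.\<close>
  also have "measure lborel (?U ?B) \<le> 4 * (real (E + Suc j) - real t) / real t"
    using e t by (intro measure_UN_primes_le) auto
  also have "\<dots> \<le> 16 * (1 / 2) ^ j"
  proof -
    have "real (E + Suc j) - real t = real e + 2 * real j + 1"
      using t by simp
    also have "\<dots> \<le> 4 * real e"
      using e by simp
    finally have num: "4 * (real (E + Suc j) - real t) \<le> 16 * real e"
      by simp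
    have "2 ^ j * e + e + j \<le> E"
    proof -
      have "2 ^ j * e \<le> 4 ^ j * e" "e \<le> 4 ^ j * e"
        by (auto intro!: mult_right_mono power_mono)
      then show ?thesis
        using e E unfolding mult.assoc by linarith
    qed
    then have "2 ^ j * e \<le> t"
      using t by simp
    then have "real (2 ^ j * e) \<le> real t"
      by (simp only: of_nat_le_iff)
    then have "4 * (real (E + Suc j) - real t) / real t \<le> 16 * real e / (2 ^ j * real e)"
      using num e by (intro frac_le) auto
    also have "\<dots> = 16 * (1 / 2) ^ j"
      using e by (simp add: power_one_over)
    finally show ?thesis .
  qed
  finally show ?thesis
    by simp
qed

text \<open>Blocks are finite and cover all large primes, so a point missed by all late blocks is
  missed by the intervals of all large primes.\<close>

lemma prime_approx_set_subset_limsup: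
  "prime_approx_set c \<subseteq> limsup (\<lambda>j. \<Union>p\<in>prime_block j. approx_interval c p)"
proof
  fix x assume x: "x \<in> prime_approx_set c"
  let ?H = "\<lambda>j. \<Union>p\<in>prime_block j. approx_interval c p"
  show "x \<in> limsup ?H"
  proof (rule ccontr)
    assume "x \<notin> limsup ?H"
    then obtain N where N: "\<And>j. j \<ge> N \<Longrightarrow> x \<notin> ?H j"
      by (auto simp: limsup_INF_SUP)
    have "eventually (\<lambda>p. 1 \<le> ereal (real p * \<bar>x - real_of_int (c p) / real p\<bar>)) primes_at_top"
      unfolding primes_at_top_def eventually_inf_principal
    proof (rule eventually_sequentiallyI, intro impI)
      fix p :: nat
      \<comment> \<open>The power puts \<open>p\<close> into some block; the sum crudely bounds
        every prime in the first \<open>N\<close> blocks, so that this block has index at least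
        \<open>N\<close>.\<close>
      assume p: "2 ^ gap_exp 0 + (\<Sum>j<N. \<Sum>(prime_block j)) + 1 \<le> p" "p \<in> {p. prime p}"
      then obtain j where j: "p \<in> prime_block j"
        using ex_prime_block[of p] by auto
      have "j \<ge> N"
      proof (rule ccontr)
        assume "\<not> j \<ge> N"
        then have "\<Sum>(prime_block j) \<le> (\<Sum>j<N. \<Sum>(prime_block j))"
          by (intro member_le_sum[of j _ "\<lambda>j. \<Sum>(prime_block j)"]) auto
        moreover have "p \<le> \<Sum>(prime_block j)"
          using j finite_prime_block by (intro member_le_sum[of p _ "\<lambda>p. p"]) auto
        ultimately show False
          using p by simp
      qed
      then have "x \<notin> approx_interval c p"
        using N j by blast
      then have "1 / real p \<le> \<bar>x - real_of_int (c p) / real p\<bar>"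
        by (auto simp: approx_interval_def diff_divide_distrib add_divide_distrib)
      then show "1 \<le> ereal (real p * \<bar>x - real_of_int (c p) / real p\<bar>)"
        using p by (simp add: field_simps)
    qed
    then have "1 \<le> Liminf primes_at_top (\<lambda>p. ereal (real p * \<bar>x - real_of_int (c p) / real p\<bar>))"
      by (rule Liminf_bounded)
    then show False
      using x by (simp add: prime_approx_set_def)
  qed
qed

lemma null_sets_prime_approx_set:
  fixes m :: "nat \<Rightarrow> nat"
  assumes c: "c = (\<lambda>p. \<lfloor>liouville * real p * real (m p)\<rfloor> mod int p)"
    and m: "\<And>p. m p \<le> p"
  shows "prime_approx_set c \<in> null_sets (lebesgue_on {0..1})"
proof -
  let ?H = "\<lambda>j. \<Union>p\<in>prime_block j. approx_interval c p"
  have H: "?H j \<in> fmeasurable lborel" for j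
    by (intro fmeasurable_UN_approx_interval finite_prime_block)
  have "summable (\<lambda>j. 64 * (1 / 2 :: real) ^ j)"
    by (intro summable_mult summable_geometric) simp
  then have "summable (\<lambda>j. measure lborel (?H j))"
    by (rule summable_comparison_test'[of _ 0]) (simp add: measure_prime_block_le[OF c m])
  then have "limsup ?H \<in> null_sets lborel"
    using H by (intro borel_cantelli_limsup1) (auto simp: fmeasurable_def)
  \<comment> \<open>Completeness of Lebesgue measure supplies measurability: the set is known only
    to lie inside a Borel null set.\<close>
  then have "prime_approx_set c \<in> null_sets lebesgue"
    by (intro null_sets_completionI null_sets_completion_subset[OF prime_approx_set_subset_limsup])
  moreover have "prime_approx_set c \<subseteq> {0..1}"
    by (auto simp: prime_approx_set_def)
  ultimately show ?thesis
    by (simp add: null_sets_restrict_space)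
qed

lemma prime_index_le: "prime_index p \<le> p"
proof -
  have "{q. prime q \<and> q \<le> p} \<subseteq> {1..p}"
    by (auto dest: prime_ge_1_nat)
  then have "card {q. prime q \<and> q \<le> p} \<le> card {1..p}"
    by (intro card_mono) auto
  then show ?thesis
    by (simp add: prime_index_def)
qed

theorem theorem1p8:
  "\<exists>\<beta>::real. \<beta> > 0 \<and> \<beta> \<notin> \<rat> \<and>
     prime_approx_set (a_seq \<beta>) \<in> null_sets (lebesgue_on {0..1}) \<and>
     prime_approx_set (b_seq \<beta>) \<in> null_sets (lebesgue_on {0..1})"
proof (intro exI[of _ liouville] conjI liouville_pos liouville_irrational)
  show "prime_approx_set (a_seq liouville) \<in> null_sets (lebesgue_on {0..1})"
    by (rule null_sets_prime_approx_set[where m = prime_index])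
       (auto simp: a_seq_def fun_eq_iff prime_index_le)
  show "prime_approx_set (b_seq liouville) \<in> null_sets (lebesgue_on {0..1})"
    by (rule null_sets_prime_approx_set[where m = "\<lambda>p. p"])
       (auto simp: b_seq_def fun_eq_iff power2_eq_square mult.assoc)
qed

end
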